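(* Let $A$ be a closed, densely defined operator in $\mathcal H$ and let $\lambda\in\sigma_{\pi_+}(A)\setminus\{\infty\}$ (resp. $\lambda\in\sigma_{\pi_-}(A)\setminus\{\infty\}$). Then $\ker(A-\lambda)$ is an Almost Pontryagin space with finite rank of non-positivity (resp. non-negativity).
   Context: $(\mathcal H,(\cdot,\cdot))$ is a Hilbert space, $G$ is a bounded selfadjoint operator in $\mathcal H$ (not assumed boundedly invertible or injective), and $[x,y]:=(Gx,y)$. "Subspace" means closed linear manifold. For a closed, densely defined operator $A$, $\sigma_{ap}(A)$ is the set of all $\lambda\in\mathbb C$ for which there is a sequence $(x_n)$ in $\operatorname{dom}A$ with $\|x_n\|=1$ and $(A-\lambda)x_n\to0$. A point $\lambda\in\sigma_{ap}(A)$ (so $\lambda\neq\infty$) belongs to $\sigma_{\pi_+}(A)$ (resp. $\sigma_{\pi_-}(A)$) if there is a linear manifold $\mathcal H_\lambda\subset\mathcal H$ with $\dim(\mathcal H/\mathcal H_\lambda)<\infty$ such that for every sequence $(x_n)$ in $\mathcal H_\lambda\cap\operatorname{dom}A$ with $\|x_n\|=1$ and $(A-\lambda)x_n\to0$ one has $\liminf_n[x_n,x_n]>0$ (resp. $\limsup_n[x_n,x_n]<0$). (These sets may also contain the point $\infty$, which is excluded here.) A subspace $\mathcal L\subset\mathcal H$ is an Almost Pontryagin space with finite rank of non-positivity (resp. non-negativity) if there is a subspace $\widetilde{\mathcal L}\subset\mathcal L$ with $\dim(\mathcal L/\widetilde{\mathcal L})<\infty$ which is uniformly positive (resp. uniformly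 negative), i.e. there is $\delta>0$ with $[x,x]\ge\delta\|x\|^2$ (resp. $-[x,x]\ge\delta\|x\|^2$) for all $x\in\widetilde{\mathcal L}$. *)

theory Defs
  imports "HOL-Analysis.Analysis"
begin

section \<open>Complex Hilbert spaces\<close>

text \<open>
  The distribution only has real inner product spaces. A complex Hilbert space is presented here
  as a complete real inner product space (with real inner product \<open>Re (x, y)\<close>, and hence
  \<open>norm x = sqrt (Re (x, x))\<close>) carrying a compatible complex scalar multiplication and a
  complex inner product that is linear in the first argument.
\<close>

class chilbert_space = real_inner + complete_space +
  fixes scaleC :: "complex \<Rightarrow> 'a \<Rightarrow> 'a" (infixr \<open>*\<^sub>C\<close> 75)
    and cinner :: "'a \<Rightarrow> 'a \<Rightarrow> complex"
  assumes scaleC_add_right: "c *\<^sub>C (x + y) = c *\<^sub>C x + c *\<^sub>C y"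
    and scaleC_add_left: "(c + d) *\<^sub>C x = c *\<^sub>C x + d *\<^sub>C x"
    and scaleC_scaleC: "c *\<^sub>C d *\<^sub>C x = (c * d) *\<^sub>C x"
    and scaleC_of_real: "complex_of_real r *\<^sub>C x = r *\<^sub>R x"
    and cinner_add_left: "cinner (x + y) z = cinner x z + cinner y z"
    and cinner_scaleC_left: "cinner (c *\<^sub>C x) y = c * cinner x y"
    and cinner_commute: "cinner y x = cnj (cinner x y)"
    and Re_cinner: "Re (cinner x y) = inner x y"

lemma norm_eq_sqrt_cinner: "norm x = sqrt (Re (cinner x x))"
  by (simp add: Re_cinner norm_eq_sqrt_inner)

instantiation complex :: chilbert_space
begin

definition scaleC_complex :: "complex \<Rightarrow> complex \<Rightarrow> complex"
  where "scaleC_complex c x = c * x"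

definition cinner_complex :: "complex \<Rightarrow> complex \<Rightarrow> complex"
  where "cinner_complex x y = x * cnj y"

instance
  by standard
    (auto simp: scaleC_complex_def cinner_complex_def algebra_simps scaleR_conv_of_real
      inner_complex_def)

end

global_interpretation complex_vector:
  vector_space "scaleC :: complex \<Rightarrow> 'a \<Rightarrow> 'a::chilbert_space"
  defines csubspace = complex_vector.subspace
    and cspan = complex_vector.span
proof
  show "1 *\<^sub>C x = x" for x :: 'a
    using scaleC_of_real[of 1 x] by simp
qed (simp_all add: scaleC_add_right scaleC_add_left scaleC_scaleC)

text \<open>\<open>dim (L / M) < \<infinity>\<close>: the cosets modulo \<open>M\<close> of finitely many elements of \<open>L\<close> span \<open>L / M\<close>.\<close>

definition finite_codim :: "'a::chilbert_space set \<Rightarrow> 'a set \<Rightarrow> bool"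
  where "finite_codim M L \<longleftrightarrow>
    (\<exists>F. finite F \<and> F \<subseteq> L \<and> (\<forall>x\<in>L. \<exists>y\<in>cspan F. x - y \<in> M))"


section \<open>Operators\<close>

definition bounded_selfadjoint :: "('a::chilbert_space \<Rightarrow> 'a) \<Rightarrow> bool"
  where "bounded_selfadjoint G \<longleftrightarrow>
    Vector_Spaces.linear scaleC scaleC G \<and>
    (\<exists>K. \<forall>x. norm (G x) \<le> K * norm x) \<and>
    (\<forall>x y. cinner (G x) y = cinner x (G y))"

text \<open>
  An unbounded operator is given by its domain \<open>D\<close> and a total function \<open>A\<close>; the values of \<open>A\<close>
  outside \<open>D\<close> are irrelevant throughout.
\<close>

definition closed_densely_defined :: "'a::chilbert_space set \<Rightarrow> ('a \<Rightarrow> 'a) \<Rightarrow> bool"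
  where "closed_densely_defined D A \<longleftrightarrow>
    csubspace D \<and>
    (\<forall>x\<in>D. \<forall>y\<in>D. A (x + y) = A x + A y) \<and>
    (\<forall>c. \<forall>x\<in>D. A (c *\<^sub>C x) = c *\<^sub>C A x) \<and>
    closed ((\<lambda>x. (x, A x)) ` D) \<and>
    closure D = UNIV"

definition eigenkernel :: "'a::chilbert_space set \<Rightarrow> ('a \<Rightarrow> 'a) \<Rightarrow> complex \<Rightarrow> 'a set"
  where "eigenkernel D A \<mu> = {x\<in>D. A x - \<mu> *\<^sub>C x = 0}"

definition approx_eigenseq ::
    "'a::chilbert_space set \<Rightarrow> ('a \<Rightarrow> 'a) \<Rightarrow> complex \<Rightarrow> (nat \<Rightarrow> 'a) \<Rightarrow> bool"
  where "approx_eigenseq D A \<mu> x \<longleftrightarrow>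
    (\<forall>n. x n \<in> D \<and> norm (x n) = 1) \<and> (\<lambda>n. A (x n) - \<mu> *\<^sub>C x n) \<longlonglongrightarrow> 0"

definition sigma_ap :: "'a::chilbert_space set \<Rightarrow> ('a \<Rightarrow> 'a) \<Rightarrow> complex set"
  where "sigma_ap D A = {\<mu>. \<exists>x. approx_eigenseq D A \<mu> x}"


section \<open>The indefinite inner product\<close>

definition gprod :: "('a::chilbert_space \<Rightarrow> 'a) \<Rightarrow> 'a \<Rightarrow> 'a \<Rightarrow> complex"
  where "gprod G x y = cinner (G x) y"

text \<open>
  For selfadjoint \<open>G\<close> the number \<open>gprod G x x\<close> is real, so taking \<open>Re\<close> below only changes the type.
  The point \<open>\<infinity>\<close> is excluded because \<open>\<mu>\<close> ranges over the complex numbers.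
\<close>

lemma gprod_self_real: "bounded_selfadjoint G \<Longrightarrow> gprod G x x \<in> \<real>"
  unfolding bounded_selfadjoint_def gprod_def
  by (metis Reals_cnj_iff cinner_commute)

definition sigma_pi_plus ::
    "('a::chilbert_space \<Rightarrow> 'a) \<Rightarrow> 'a set \<Rightarrow> ('a \<Rightarrow> 'a) \<Rightarrow> complex set"
  where "sigma_pi_plus G D A = {\<mu> \<in> sigma_ap D A.
    \<exists>M. csubspace M \<and> finite_codim M UNIV \<and>
      (\<forall>x. (\<forall>n. x n \<in> M) \<and> approx_eigenseq D A \<mu> x \<longrightarrow>
        liminf (\<lambda>n. ereal (Re (gprod G (x n) (x n)))) > 0)}"

definition sigma_pi_minus ::
    "('a::chilbert_space \<Rightarrow> 'a) \<Rightarrow> 'a set \<Rightarrow> ('a \<Rightarrow> 'a) \<Rightarrow> complex set"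
  where "sigma_pi_minus G D A = {\<mu> \<in> sigma_ap D A.
    \<exists>M. csubspace M \<and> finite_codim M UNIV \<and>
      (\<forall>x. (\<forall>n. x n \<in> M) \<and> approx_eigenseq D A \<mu> x \<longrightarrow>
        limsup (\<lambda>n. ereal (Re (gprod G (x n) (x n)))) < 0)}"

definition uniformly_positive :: "('a::chilbert_space \<Rightarrow> 'a) \<Rightarrow> 'a set \<Rightarrow> bool"
  where "uniformly_positive G L \<longleftrightarrow> (\<exists>\<delta>>0. \<forall>x\<in>L. Re (gprod G x x) \<ge> \<delta> * (norm x)\<^sup>2)"

definition uniformly_negative :: "('a::chilbert_space \<Rightarrow> 'a) \<Rightarrow> 'a set \<Rightarrow> bool"
  where "uniformly_negative G L \<longleftrightarrow> (\<exists>\<delta>>0. \<forall>x\<in>L. - Re (gprod G x x) \<ge> \<delta> * (norm x)\<^sup>2)"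

definition closed_csubspace :: "'a::chilbert_space set \<Rightarrow> bool"
  where "closed_csubspace L \<longleftrightarrow> csubspace L \<and> closed L"

definition almost_pontryagin_nonpos :: "('a::chilbert_space \<Rightarrow> 'a) \<Rightarrow> 'a set \<Rightarrow> bool"
  where "almost_pontryagin_nonpos G L \<longleftrightarrow> closed_csubspace L \<and>
    (\<exists>M\<subseteq>L. closed_csubspace M \<and> finite_codim M L \<and> uniformly_positive G M)"

definition almost_pontryagin_nonneg :: "('a::chilbert_space \<Rightarrow> 'a) \<Rightarrow> 'a set \<Rightarrow> bool"
  where "almost_pontryagin_nonneg G L \<longleftrightarrow> closed_csubspace L \<and>
    (\<exists>M\<subseteq>L. closed_csubspace M \<and> finite_codim M L \<and> uniformly_negative G M)"

end

theory Submission imports Defs begin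

text \<open>
  On \<open>ker (A - \<mu>) \<inter> M\<close>, where \<open>M\<close> is the manifold of finite codimension that witnesses the sign
  type of \<open>\<mu>\<close>, every normalised sequence is an approximate eigensequence. If \<open>[x, x]\<close> were not
  bounded below by a positive multiple of \<open>(norm x)\<^sup>2\<close> there, a sequence of unit vectors with
  \<open>[x\<^sub>n, x\<^sub>n] < 1 / (n + 1)\<close> would contradict the sign type. The bound extends to the closure of
  \<open>ker (A - \<mu>) \<inter> M\<close>, which has finite codimension in \<open>ker (A - \<mu>)\<close>.
\<close>

lemma norm_scaleC: "norm (c *\<^sub>C x) = cmod c * norm (x :: 'a::chilbert_space)"
proof -
  have "cinner (c *\<^sub>C x) (c *\<^sub>C x) = c * cnj (c * cinner x x)"
    by (metis cinner_commute cinner_scaleC_left)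
  also have "\<dots> = of_real ((cmod c)\<^sup>2) * cinner x x"
    using cinner_commute[of x x] complex_norm_square[of c] by (simp add: mult.assoc)
  finally have "Re (cinner (c *\<^sub>C x) (c *\<^sub>C x)) = (cmod c)\<^sup>2 * Re (cinner x x)"
    by simp
  then show ?thesis
    by (simp add: norm_eq_sqrt_cinner[where 'a = 'a] real_sqrt_mult)
qed

lemma bounded_linear_scaleC: "bounded_linear (\<lambda>x :: 'a::chilbert_space. c *\<^sub>C x)"
proof (rule bounded_linear_intro[where K = "cmod c"])
  show "c *\<^sub>C (r *\<^sub>R x) = r *\<^sub>R (c *\<^sub>C x)" for r and x :: 'a
    by (simp flip: scaleC_of_real add: scaleC_scaleC mult.commute)
qed (simp_all add: scaleC_add_right norm_scaleC)

lemma csubspace_closure: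
  fixes S :: "'a::chilbert_space set"
  assumes "csubspace S"
  shows "csubspace (closure S)"
  unfolding complex_vector.subspace_def
proof (intro conjI ballI allI)
  show "0 \<in> closure S"
    using complex_vector.subspace_0[OF assms] closure_subset by blast
next
  fix x y assume "x \<in> closure S" "y \<in> closure S"
  then obtain f g where "\<And>n. f n \<in> S" "f \<longlonglongrightarrow> x" "\<And>n. g n \<in> S" "g \<longlonglongrightarrow> y"
    unfolding closure_sequential by blast
  then show "x + y \<in> closure S"
    unfolding closure_sequential
    by (intro exI[of _ "\<lambda>n. f n + g n"])
      (auto intro: tendsto_add complex_vector.subspace_add[OF assms])
next
  fix c x assume "x \<in> closure S"
  then obtain f where "\<And>n. f n \<in> S" "f \<longlonglongrightarrow> x"
    unfolding closure_sequential by blast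
  then show "c *\<^sub>C x \<in> closure S"
    unfolding closure_sequential
    by (intro exI[of _ "\<lambda>n. c *\<^sub>C f n"])
      (auto intro: bounded_linear.tendsto[OF bounded_linear_scaleC]
        complex_vector.subspace_scale[OF assms])
qed

lemma finite_codim_Int_if_spanned:
  fixes M L F :: "'a::chilbert_space set"
  assumes "finite F" and M: "csubspace M" and "csubspace L"
    and "\<forall>x\<in>L. \<exists>y\<in>cspan F. x - y \<in> M"
  shows "finite_codim (L \<inter> M) L"
  using assms(1,3,4)
proof (induction F arbitrary: L rule: finite_induct)
  case empty
  then show ?case
    unfolding finite_codim_def by (intro exI[of _ "{}"]) auto
next
  case (insert a F)
  note L = \<open>csubspace L\<close>
  define L' where "L' = {x\<in>L. \<exists>y\<in>cspan F. x - y \<in> M}"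
  have combination: "x - c *\<^sub>C x0 - (y - c *\<^sub>C y0) \<in> M"
    if "x - y \<in> M" "x0 - y0 \<in> M" for c x x0 y y0
  proof -
    have "(x - y) - c *\<^sub>C (x0 - y0) \<in> M"
      using complex_vector.subspace_diff[OF M that(1) complex_vector.subspace_scale[OF M that(2)]] .
    then show ?thesis
      by (simp add: complex_vector.scale_right_diff_distrib algebra_simps)
  qed
  have L': "csubspace L'"
    unfolding complex_vector.subspace_def
  proof (intro conjI ballI allI)
    show "0 \<in> L'"
      using complex_vector.subspace_0[OF L] complex_vector.subspace_0[OF M]
      unfolding L'_def by (auto intro!: bexI[of _ 0] complex_vector.span_zero)
  next
    fix x y assume "x \<in> L'" "y \<in> L'"
    then obtain u v where uv: "x \<in> L" "u \<in> cspan F" "x - u \<in> M" "y \<in> L" "v \<in> cspan F" "y - v \<in> M"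
      unfolding L'_def by blast
    then have "x + y - (u + v) \<in> M"
      using complex_vector.subspace_add[OF M uv(3,6)] by (simp add: algebra_simps)
    then show "x + y \<in> L'"
      using uv L complex_vector.subspace_add[OF L] complex_vector.span_add
      unfolding L'_def by blast
  next
    fix c x assume "x \<in> L'"
    then obtain u where u: "x \<in> L" "u \<in> cspan F" "x - u \<in> M"
      unfolding L'_def by blast
    then have "c *\<^sub>C x - c *\<^sub>C u \<in> M"
      using complex_vector.subspace_scale[OF M u(3)]
      by (simp add: complex_vector.scale_right_diff_distrib)
    then show "c *\<^sub>C x \<in> L'"
      using u L complex_vector.subspace_scale[OF L] complex_vector.span_scale
      unfolding L'_def by blast
  qed
  have "finite_codim (L' \<inter> M) L'"
    using L' by (rule insert.IH) (auto simp: L'_def)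
  then obtain F' where F': "finite F'" "F' \<subseteq> L'" "\<forall>x\<in>L'. \<exists>y\<in>cspan F'. x - y \<in> L' \<inter> M"
    unfolding finite_codim_def by blast
  have "L' \<subseteq> L"
    unfolding L'_def by blast
  show ?case
  proof (cases "L' = L")
    case True
    then show ?thesis
      using F' unfolding finite_codim_def by blast
  next
    case False
    with \<open>L' \<subseteq> L\<close> obtain x0 where x0: "x0 \<in> L" "x0 \<notin> L'"
      by blast
    then obtain y0 c0 where y0: "x0 - y0 \<in> M" "y0 - c0 *\<^sub>C a \<in> cspan F"
      using insert.prems(2) complex_vector.span_breakdown_eq by metis
    have "c0 \<noteq> 0"
      using x0 y0 unfolding L'_def by auto
    have "\<exists>y\<in>cspan (insert x0 F'). x - y \<in> L \<inter> M" if x: "x \<in> L" for x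
    proof -
      obtain y c where y: "x - y \<in> M" "y - c *\<^sub>C a \<in> cspan F"
        using insert.prems(2) x complex_vector.span_breakdown_eq by metis
      define k where "k = c / c0"
      have "y - k *\<^sub>C y0 = (y - c *\<^sub>C a) - k *\<^sub>C (y0 - c0 *\<^sub>C a)"
        using \<open>c0 \<noteq> 0\<close> by (simp add: complex_vector.scale_right_diff_distrib k_def scaleC_scaleC)
      then have "y - k *\<^sub>C y0 \<in> cspan F"
        using y y0 by (metis complex_vector.span_diff complex_vector.span_scale)
      moreover have "x - k *\<^sub>C x0 \<in> L"
        using x x0 L by (intro complex_vector.subspace_diff complex_vector.subspace_scale)
      ultimately have "x - k *\<^sub>C x0 \<in> L'"
        using combination[OF y(1) y0(1)] unfolding L'_def by blast
      then obtain z where z: "z \<in> cspan F'" "x - k *\<^sub>C x0 - z \<in> L' \<inter> M"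
        using F' by blast
      have "k *\<^sub>C x0 + z \<in> cspan (insert x0 F')"
        using z(1) by (simp add: complex_vector.span_add complex_vector.span_scale
            complex_vector.span_base complex_vector.span_mono[THEN subsetD, OF subset_insertI])
      moreover have "x - (k *\<^sub>C x0 + z) \<in> L \<inter> M"
        using z(2) \<open>L' \<subseteq> L\<close> by (auto simp: algebra_simps)
      ultimately show ?thesis
        by blast
    qed
    then show ?thesis
      using F' x0 \<open>L' \<subseteq> L\<close> unfolding finite_codim_def
      by (intro exI[of _ "insert x0 F'"]) auto
  qed
qed

lemma finite_codim_Int:
  assumes "csubspace M" "csubspace L" "finite_codim M UNIV"
  shows "finite_codim (L \<inter> M) L"
proof -
  obtain F where "finite F" "\<forall>x\<in>L. \<exists>y\<in>cspan F. x - y \<in> M"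
    using assms(3) unfolding finite_codim_def by auto
  with assms(1,2) show ?thesis
    by (intro finite_codim_Int_if_spanned)
qed

lemma finite_codim_mono: "finite_codim M L \<Longrightarrow> M \<subseteq> M' \<Longrightarrow> finite_codim M' L"
  unfolding finite_codim_def by (meson subsetD)

lemma closed_csubspace_eigenkernel:
  fixes A :: "'a::chilbert_space \<Rightarrow> 'a"
  assumes "closed_densely_defined D A"
  shows "closed_csubspace (eigenkernel D A \<mu>)"
proof -
  have D: "csubspace D"
    and add: "\<And>x y. x \<in> D \<Longrightarrow> y \<in> D \<Longrightarrow> A (x + y) = A x + A y"
    and scale: "\<And>c x. x \<in> D \<Longrightarrow> A (c *\<^sub>C x) = c *\<^sub>C A x"
    and graph: "closed ((\<lambda>x. (x, A x)) ` D)"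
    using assms unfolding closed_densely_defined_def by auto
  have "A 0 = 0"
    using scale[of 0 0] complex_vector.subspace_0[OF D] by simp
  then have "csubspace (eigenkernel D A \<mu>)"
    using D unfolding complex_vector.subspace_def eigenkernel_def
    by (simp add: add scale scaleC_add_right scaleC_scaleC mult.commute)
  moreover have "eigenkernel D A \<mu> = (\<lambda>x. (x, \<mu> *\<^sub>C x)) -` ((\<lambda>x. (x, A x)) ` D)"
    unfolding eigenkernel_def by (auto simp: image_iff)
  then have "closed (eigenkernel D A \<mu>)"
    by (simp only:)
      (intro closed_vimage graph continuous_on_Pair continuous_on_id
        linear_continuous_on bounded_linear_scaleC)
  ultimately show ?thesis
    unfolding closed_csubspace_def by blast
qed

lemma continuous_Re_gprod:
  fixes G :: "'a::chilbert_space \<Rightarrow> 'a"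
  assumes "bounded_selfadjoint G"
  shows "continuous_on UNIV (\<lambda>x. Re (gprod G x x))"
proof -
  obtain K where G: "Vector_Spaces.linear scaleC scaleC G" and K: "\<And>x. norm (G x) \<le> K * norm x"
    using assms unfolding bounded_selfadjoint_def by blast
  have "bounded_linear G"
    using G[THEN Vector_Spaces.linear.axioms(3), THEN module_hom.scale, of "complex_of_real _"] K
    by (intro bounded_linear_intro[where K = K])
      (simp_all add: G[THEN Vector_Spaces.linear.axioms(3), THEN module_hom.add]
        scaleC_of_real mult.commute)
  then show ?thesis
    unfolding gprod_def Re_cinner
    by (intro continuous_on_inner continuous_on_id linear_continuous_on)
qed

lemma Re_gprod_scaleR:
  fixes G :: "'a::chilbert_space \<Rightarrow> 'a"
  assumes "bounded_selfadjoint G"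
  shows "Re (gprod G (r *\<^sub>R x) (r *\<^sub>R x)) = r\<^sup>2 * Re (gprod G x x)"
proof -
  have "Vector_Spaces.linear scaleC scaleC G"
    using assms unfolding bounded_selfadjoint_def by blast
  from this[THEN Vector_Spaces.linear.axioms(3), THEN module_hom.scale, of "complex_of_real r" x]
  show ?thesis
    by (simp add: gprod_def Re_cinner scaleC_of_real power2_eq_square)
qed

lemma eigenkernel_definite_part:
  fixes A :: "'a::chilbert_space \<Rightarrow> 'a" and q :: "'a \<Rightarrow> real"
  assumes A: "closed_densely_defined D A"
    and q: "continuous_on UNIV q" "\<And>r x. q (r *\<^sub>R x) = r\<^sup>2 * q x"
    and M: "csubspace M" "finite_codim M UNIV"
    and pos: "\<And>x. (\<And>n. x n \<in> M) \<Longrightarrow> approx_eigenseq D A \<mu> x \<Longrightarrow> liminf (\<lambda>n. ereal (q (x n))) > 0"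
  shows "\<exists>N\<subseteq>eigenkernel D A \<mu>. closed_csubspace N \<and> finite_codim N (eigenkernel D A \<mu>) \<and>
    (\<exists>\<delta>>0. \<forall>x\<in>N. q x \<ge> \<delta> * (norm x)\<^sup>2)"
proof -
  define K where "K = eigenkernel D A \<mu>"
  have K: "csubspace K" "closed K"
    using closed_csubspace_eigenkernel[OF A] unfolding closed_csubspace_def K_def by auto
  have KM: "csubspace (K \<inter> M)"
    using K(1) M(1) by (rule complex_vector.subspace_inter)
  have "\<exists>\<delta>>0. \<forall>x\<in>K \<inter> M. q x \<ge> \<delta> * (norm x)\<^sup>2"
  proof (rule ccontr)
    assume neg: "\<not> ?thesis"
    have "\<exists>u. u \<in> K \<inter> M \<and> norm u = 1 \<and> q u < 1 / real (Suc n)" for n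
    proof -
      obtain x where x: "x \<in> K \<inter> M" "q x < 1 / real (Suc n) * (norm x)\<^sup>2"
        using neg by (metis not_less of_nat_0_less_iff zero_less_Suc zero_less_divide_1_iff)
      have "x \<noteq> 0"
        using x(2) q(2)[of 0 0] by auto
      have "complex_of_real (1 / norm x) *\<^sub>C x \<in> K \<inter> M"
        using complex_vector.subspace_scale[OF KM x(1)] .
      then have "(1 / norm x) *\<^sub>R x \<in> K \<inter> M"
        by (simp only: scaleC_of_real)
      moreover have "q ((1 / norm x) *\<^sub>R x) < 1 / real (Suc n)"
        unfolding q(2) using x(2) \<open>x \<noteq> 0\<close> by (simp add: field_simps)
      ultimately show ?thesis
        using \<open>x \<noteq> 0\<close> by (intro exI[of _ "(1 / norm x) *\<^sub>R x"]) auto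
    qed
    then obtain u where u: "\<And>n. u n \<in> K \<inter> M" "\<And>n. norm (u n) = 1" "\<And>n. q (u n) < 1 / real (Suc n)"
      by metis
    have "approx_eigenseq D A \<mu> u"
      using u unfolding approx_eigenseq_def K_def eigenkernel_def by auto
    then have "liminf (\<lambda>n. ereal (q (u n))) > 0"
      using u by (intro pos) auto
    moreover have "liminf (\<lambda>n. ereal (q (u n))) \<le> liminf (\<lambda>n. ereal (1 / real (Suc n)))"
      using u(3) by (intro Liminf_mono always_eventually) (auto intro: less_imp_le)
    moreover have "(\<lambda>n. ereal (1 / real (Suc n))) \<longlonglongrightarrow> ereal 0"
      using LIMSEQ_inverse_real_of_nat by (simp add: inverse_eq_divide)
    then have "liminf (\<lambda>n. ereal (1 / real (Suc n))) = 0"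
      by (simp add: lim_imp_Liminf zero_ereal_def)
    ultimately show False
      by simp
  qed
  then obtain \<delta> where \<delta>: "\<delta> > 0" "\<And>x. x \<in> K \<inter> M \<Longrightarrow> q x \<ge> \<delta> * (norm x)\<^sup>2"
    by blast
  have "closed {x. \<delta> * (norm x)\<^sup>2 \<le> q x}"
    using q(1) by (intro closed_Collect_le continuous_intros)
  then have "closure (K \<inter> M) \<subseteq> {x. \<delta> * (norm x)\<^sup>2 \<le> q x}"
    using \<delta>(2) by (intro closure_minimal) auto
  moreover have "closure (K \<inter> M) \<subseteq> K"
    using K(2) by (intro closure_minimal) auto
  moreover have "finite_codim (closure (K \<inter> M)) K"
    using finite_codim_Int[OF M(1) K(1) M(2)] closure_subset by (rule finite_codim_mono)
  moreover have "closed_csubspace (closure (K \<inter> M))"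
    using csubspace_closure[OF KM] unfolding closed_csubspace_def by simp
  ultimately show ?thesis
    using \<delta>(1) unfolding K_def by blast
qed

theorem lemma3p10:
  fixes G :: "'a::chilbert_space \<Rightarrow> 'a"
    and D :: "'a set"
    and A :: "'a \<Rightarrow> 'a"
    and \<mu> :: complex
  assumes "bounded_selfadjoint G"
    and "closed_densely_defined D A"
  shows "(\<mu> \<in> sigma_pi_plus G D A \<longrightarrow> almost_pontryagin_nonpos G (eigenkernel D A \<mu>)) \<and>
    (\<mu> \<in> sigma_pi_minus G D A \<longrightarrow> almost_pontryagin_nonneg G (eigenkernel D A \<mu>))"
proof (intro conjI impI)
  note G = continuous_Re_gprod[OF assms(1)] Re_gprod_scaleR[OF assms(1)]
  {
    assume "\<mu> \<in> sigma_pi_plus G D A"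
    then obtain M where "csubspace M" "finite_codim M UNIV"
      and "\<And>x. (\<And>n. x n \<in> M) \<Longrightarrow> approx_eigenseq D A \<mu> x \<Longrightarrow>
        liminf (\<lambda>n. ereal (Re (gprod G (x n) (x n)))) > 0"
      unfolding sigma_pi_plus_def by blast
    from eigenkernel_definite_part[OF assms(2) G this]
    show "almost_pontryagin_nonpos G (eigenkernel D A \<mu>)"
      using closed_csubspace_eigenkernel[OF assms(2)]
      unfolding almost_pontryagin_nonpos_def uniformly_positive_def by blast
  next
    assume "\<mu> \<in> sigma_pi_minus G D A"
    then obtain M where M: "csubspace M" "finite_codim M UNIV"
      and neg: "\<And>x. (\<And>n. x n \<in> M) \<Longrightarrow> approx_eigenseq D A \<mu> x \<Longrightarrow>
        limsup (\<lambda>n. ereal (Re (gprod G (x n) (x n)))) < 0"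
      unfolding sigma_pi_minus_def by blast
    have "liminf (\<lambda>n. ereal (- Re (gprod G (x n) (x n)))) > 0"
      if "\<And>n. x n \<in> M" "approx_eigenseq D A \<mu> x" for x
      using neg[OF that] ereal_Liminf_uminus[of sequentially "\<lambda>n. ereal (Re (gprod G (x n) (x n)))"]
      by (simp add: ereal_less_uminus_reorder)
    from eigenkernel_definite_part[OF assms(2) continuous_on_minus[OF G(1)] _ M this]
    show "almost_pontryagin_nonneg G (eigenkernel D A \<mu>)"
      using closed_csubspace_eigenkernel[OF assms(2)] G(2)
      unfolding almost_pontryagin_nonneg_def uniformly_negative_def by simp
  }
qed

end
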